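(* Let $\mathbb{F}$ be a field of characteristic zero, $V=V_0\oplus V_1$ a vector superspace over $\mathbb{F}$, $f$ a supersymmetric nondegenerate bilinear form on $V$, and $\star$ a superanticommutative multiplication on $V$ such that $f(x\star y,z)=f(x,y\star z)$ for all $x,y,z\in V$. Then $$Der(U(V,f,\star))=Lieosp(V,f)\cap Der(V,\star).$$
   Context: Supersymmetric means $f(V_0,V_1)=0$ and $f(x,y)=(-1)^{p(x)p(y)}f(y,x)$ for homogeneous $x,y$ ($p$ denotes parity); superanticommutative means $V_i\star V_j\subseteq V_{i+j}$ and $x\star y=-(-1)^{p(x)p(y)}y\star x$ for homogeneous $x,y$. $U(V,f,\star)$ is the superalgebra $\mathbb{F}\oplus V$ (with even part $\mathbb{F}\oplus V_0$ and odd part $V_1$) with multiplication $(\alpha+x)(\beta+y)=(\alpha\beta+f(x,y))+(\alpha y+\beta x+x\star y)$ for $\alpha,\beta\in\mathbb{F}$, $x,y\in V$. Linear maps are written on the right. A homogeneous linear map $d$ of a superalgebra is a derivation if $(xy)d=(-1)^{p(d)p(y)}(xd)y+x(yd)$ for all homogeneous $x,y$; $Der$ denotes the Lie superalgebra spanned by the even and odd derivations. $Der(V,\star)$ is the derivation superalgebra of the superalgebra $(V,\star)$. $Lieosp(V,f)=Lieosp(V,f)_{\bar0}\oplus Lieosp(V,f)_{\bar1}$, where, for $s\in\{\bar0,\bar1\}$, $Lieosp(V,f)_s$ is the set of $d\in End(V)_s$ such that $(-1)^{s\,p(v)}f(wd,v)+f(w,vd)=0$ for all homogeneous $w,v\in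 V$. A linear map $d$ of $V$ is identified with the linear map of $\mathbb{F}\oplus V$ that extends it by $1d=0$. *)

theory Defs
  imports Main "HOL.Vector_Spaces" "HOL-Library.Z2" "HOL-Library.Function_Algebras"
    "HOL-Library.Product_Plus"
begin

(* Parities are elements of the two-element field bit, so that parities of products and of
   maps add up in bit. A superspace is a vector space together with its family
   V :: bit \<Rightarrow> 'v set of homogeneous components; a homogeneous element of parity i is an
   element of V i (so 0 is homogeneous of both parities). *)

locale superspace = vector_space scale
  for scale :: "'f::field \<Rightarrow> 'v::ab_group_add \<Rightarrow> 'v" +
  fixes V :: "bit \<Rightarrow> 'v set"
  assumes subspace_component: "subspace (V i)"
    and components_disjoint: "V 0 \<inter> V 1 = {0}"
    and components_span: "\<exists>x0\<in>V 0. \<exists>x1\<in>V 1. x = x0 + x1"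

(* The sign (-1)^(s t). *)
definition parity_sign :: "bit \<Rightarrow> bit \<Rightarrow> 'f::field" where
  "parity_sign s t = (if s * t = 0 then 1 else - 1)"

definition bilinear_map ::
  "('f::field \<Rightarrow> 'a::ab_group_add \<Rightarrow> 'a) \<Rightarrow> ('f \<Rightarrow> 'b::ab_group_add \<Rightarrow> 'b) \<Rightarrow> ('a \<Rightarrow> 'a \<Rightarrow> 'b) \<Rightarrow> bool" where
  "bilinear_map s1 s2 b \<longleftrightarrow>
     (\<forall>x. Vector_Spaces.linear s1 s2 (\<lambda>y. b x y)) \<and> (\<forall>y. Vector_Spaces.linear s1 s2 (\<lambda>x. b x y))"

abbreviation bilinear_form ::
  "('f::field \<Rightarrow> 'v::ab_group_add \<Rightarrow> 'v) \<Rightarrow> ('v \<Rightarrow> 'v \<Rightarrow> 'f) \<Rightarrow> bool" where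
  "bilinear_form scale f \<equiv> bilinear_map scale (*) f"

definition nondegenerate :: "('v::zero \<Rightarrow> 'v \<Rightarrow> 'f::zero) \<Rightarrow> bool" where
  "nondegenerate f \<longleftrightarrow>
     (\<forall>x. (\<forall>y. f x y = 0) \<longrightarrow> x = 0) \<and> (\<forall>y. (\<forall>x. f x y = 0) \<longrightarrow> y = 0)"

definition supersymmetric :: "(bit \<Rightarrow> 'v set) \<Rightarrow> ('v \<Rightarrow> 'v \<Rightarrow> 'f::field) \<Rightarrow> bool" where
  "supersymmetric V f \<longleftrightarrow>
     (\<forall>x\<in>V 0. \<forall>y\<in>V 1. f x y = 0) \<and>
     (\<forall>i j. \<forall>x\<in>V i. \<forall>y\<in>V j. f x y = parity_sign i j * f y x)"

definition superanticommutative ::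
  "('f::field \<Rightarrow> 'v::ab_group_add \<Rightarrow> 'v) \<Rightarrow> (bit \<Rightarrow> 'v set) \<Rightarrow> ('v \<Rightarrow> 'v \<Rightarrow> 'v) \<Rightarrow> bool" where
  "superanticommutative scale V m \<longleftrightarrow>
     (\<forall>i j. \<forall>x\<in>V i. \<forall>y\<in>V j. m x y \<in> V (i + j)) \<and>
     (\<forall>i j. \<forall>x\<in>V i. \<forall>y\<in>V j. m x y = - scale (parity_sign i j) (m y x))"

definition super_End ::
  "('f::field \<Rightarrow> 'v::ab_group_add \<Rightarrow> 'v) \<Rightarrow> (bit \<Rightarrow> 'v set) \<Rightarrow> bit \<Rightarrow> ('v \<Rightarrow> 'v) set" where
  "super_End scale V s = {d. Vector_Spaces.linear scale scale d \<and> (\<forall>i. d ` V i \<subseteq> V (i + s))}"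

(* Linear maps act on the right in the usual convention for this sign rule:
   (xy)d = (-1)^(p(d)p(y)) (xd)y + x(yd). Below, d x denotes the value xd. *)
definition homogeneous_derivations ::
  "('f::field \<Rightarrow> 'v::ab_group_add \<Rightarrow> 'v) \<Rightarrow> (bit \<Rightarrow> 'v set) \<Rightarrow> ('v \<Rightarrow> 'v \<Rightarrow> 'v) \<Rightarrow> bit \<Rightarrow> ('v \<Rightarrow> 'v) set" where
  "homogeneous_derivations scale V m s =
     {d \<in> super_End scale V s. \<forall>i j. \<forall>x\<in>V i. \<forall>y\<in>V j.
        d (m x y) = scale (parity_sign s j) (m (d x) y) + m x (d y)}"

(* The span is taken in the vector space of all functions with pointwise operations. *)
definition Der ::
  "('f::field \<Rightarrow> 'v::ab_group_add \<Rightarrow> 'v) \<Rightarrow> (bit \<Rightarrow> 'v set) \<Rightarrow> ('v \<Rightarrow> 'v \<Rightarrow> 'v) \<Rightarrow> ('v \<Rightarrow> 'v) set" where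
  "Der scale V m = module.span (\<lambda>c d x. scale c (d x))
     (homogeneous_derivations scale V m 0 \<union> homogeneous_derivations scale V m 1)"

definition Lieosp_component ::
  "('f::field \<Rightarrow> 'v::ab_group_add \<Rightarrow> 'v) \<Rightarrow> (bit \<Rightarrow> 'v set) \<Rightarrow> ('v \<Rightarrow> 'v \<Rightarrow> 'f) \<Rightarrow> bit \<Rightarrow> ('v \<Rightarrow> 'v) set" where
  "Lieosp_component scale V f s =
     {d \<in> super_End scale V s. \<forall>i j. \<forall>w\<in>V i. \<forall>v\<in>V j.
        parity_sign s j * f (d w) v + f w (d v) = 0}"

definition Lieosp ::
  "('f::field \<Rightarrow> 'v::ab_group_add \<Rightarrow> 'v) \<Rightarrow> (bit \<Rightarrow> 'v set) \<Rightarrow> ('v \<Rightarrow> 'v \<Rightarrow> 'f) \<Rightarrow> ('v \<Rightarrow> 'v) set" where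
  "Lieosp scale V f =
     {d0 + d1 | d0 d1. d0 \<in> Lieosp_component scale V f 0 \<and> d1 \<in> Lieosp_component scale V f 1}"

(* The superalgebra U(V, f, m) lives on the product type 'f \<times> 'v: the pair (a, x) is a + x. *)
definition U_scale ::
  "('f::field \<Rightarrow> 'v \<Rightarrow> 'v) \<Rightarrow> 'f \<Rightarrow> 'f \<times> 'v \<Rightarrow> 'f \<times> 'v" where
  "U_scale scale c = (\<lambda>(a, x). (c * a, scale c x))"

definition U_component :: "(bit \<Rightarrow> 'v set) \<Rightarrow> bit \<Rightarrow> ('f::field \<times> 'v) set" where
  "U_component V i = (if i = 0 then UNIV \<times> V 0 else {0} \<times> V 1)"

definition U_mult ::
  "('f::field \<Rightarrow> 'v::ab_group_add \<Rightarrow> 'v) \<Rightarrow> ('v \<Rightarrow> 'v \<Rightarrow> 'f) \<Rightarrow> ('v \<Rightarrow> 'v \<Rightarrow> 'v) \<Rightarrow>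
     'f \<times> 'v \<Rightarrow> 'f \<times> 'v \<Rightarrow> 'f \<times> 'v" where
  "U_mult scale f m = (\<lambda>(a, x) (b, y). (a * b + f x y, scale a y + scale b x + m x y))"

(* The extension of d to 'f \<times> 'v sending the unit (1, 0) to 0. *)
definition U_extend :: "('v \<Rightarrow> 'v) \<Rightarrow> 'f::field \<times> 'v \<Rightarrow> 'f \<times> 'v" where
  "U_extend d = (\<lambda>(a, x). (0, d x))"

end

theory Submission
  imports Defs
begin

text \<open>A homogeneous derivation \<open>D\<close> of \<open>U\<close> kills the unit. Let \<open>\<phi> x\<close> and \<open>d x\<close> be the components of
  \<open>D x\<close> in \<open>F\<close> and \<open>V\<close> for \<open>x \<in> V\<close>. Once \<open>\<phi> = 0\<close>, the two components of the derivation rule on \<open>V\<close>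
  say exactly that \<open>d\<close> lies in \<open>Lieosp\<close> and is a derivation of \<open>\<star>\<close>. To see \<open>\<phi> = 0\<close>, apply \<open>D\<close> to
  the supersymmetrised product of homogeneous \<open>x\<close>, \<open>y\<close>, which is a scalar: all products \<open>\<star>\<close> cancel and
  a linear relation between \<open>x\<close> and \<open>y\<close> with coefficients \<open>\<phi> y\<close>, \<open>\<phi> x\<close> remains. For even \<open>D\<close>, \<open>x = y\<close>
  gives \<open>\<phi> x = 0\<close>; for odd \<open>D\<close>, \<open>\<phi> x \<noteq> 0\<close> would make the odd part the line through \<open>x\<close>, on
  which the skew-symmetric \<open>f\<close> vanishes, against nondegeneracy.\<close>

section \<open>Signs, bilinear maps and spaces of functions\<close>

lemma parity_sign_simps [simp]:
  "parity_sign 0 t = 1" "parity_sign s 0 = 1" "parity_sign 1 1 = - 1"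
  by (simp_all add: parity_sign_def)

lemma bilinear_map_iff:
  "bilinear_map s1 s2 b \<longleftrightarrow> vector_space s1 \<and> vector_space s2 \<and>
     (\<forall>x y z. b x (y + z) = b x y + b x z) \<and> (\<forall>c x y. b x (s1 c y) = s2 c (b x y)) \<and>
     (\<forall>x y z. b (x + y) z = b x z + b y z) \<and> (\<forall>c x y. b (s1 c x) y = s2 c (b x y))"
  unfolding bilinear_map_def Vector_Spaces.linear_iff by blast

lemma bilinear_map_0:
  assumes "bilinear_map s1 s2 b"
  shows "b 0 y = 0" "b x 0 = 0"
  using assms unfolding bilinear_map_iff by (metis add_cancel_left_left)+

text \<open>\<open>Der\<close> is a span inside this space of functions, so this gives access to the
  library facts on spans and subspaces.\<close>

lemma vector_space_fun:
  assumes "vector_space scale"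
  shows "vector_space (\<lambda>c d x. scale c (d x))"
proof -
  interpret vector_space scale by fact
  show ?thesis
    by unfold_locales (auto simp: fun_eq_iff scale_right_distrib scale_left_distrib)
qed

section \<open>Homogeneous maps of a superspace and splitting by parity\<close>

context superspace
begin

lemma subspace_super_End:
  "module.subspace (\<lambda>c d x. scale c (d x)) (super_End scale V s)"
proof -
  interpret fn: vector_space "\<lambda>c d x. scale c (d x)"
    by (rule vector_space_fun) unfold_locales
  have "vector_space scale" by unfold_locales
  then show ?thesis
    unfolding fn.subspace_def super_End_def Vector_Spaces.linear_iff
    using subspace_component
    by (auto simp: image_subset_iff subspace_0 subspace_add subspace_scale scale_right_distrib
        scale_left_commute algebra_simps)
qed

lemma subspace_homogeneous_derivations:
  assumes m: "bilinear_map scale scale m"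
  shows "module.subspace (\<lambda>c d x. scale c (d x)) (homogeneous_derivations scale V m s)"
proof -
  interpret fn: vector_space "\<lambda>c d x. scale c (d x)"
    by (rule vector_space_fun) unfold_locales
  show ?thesis
    using subspace_super_End[of s] m bilinear_map_0[OF m]
    unfolding fn.subspace_def homogeneous_derivations_def bilinear_map_iff
    by (simp add: scale_right_distrib scale_left_commute algebra_simps)
qed

text \<open>The homogeneous derivations of a fixed parity already form a subspace, and the span of a
  union of two subspaces is their sum.\<close>

lemma Der_eq_sum:
  assumes "bilinear_map scale scale m"
  shows "Der scale V m = {d0 + d1 | d0 d1. d0 \<in> homogeneous_derivations scale V m 0 \<and>
                                          d1 \<in> homogeneous_derivations scale V m 1}"
proof -
  interpret fn: vector_space "\<lambda>c d x. scale c (d x)"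
    by (rule vector_space_fun) unfold_locales
  show ?thesis
    unfolding Der_def fn.span_Un
    using subspace_homogeneous_derivations[OF assms] by (simp add: fn.span_eq_iff[THEN iffD2])
qed

lemma super_End_disjoint:
  assumes "d \<in> super_End scale V 0" "d \<in> super_End scale V 1"
  shows "d = 0"
proof
  fix x
  have *: "d y \<in> V 0 \<inter> V 1" if "y \<in> V i" for y i
  proof -
    \<comment> \<open>\<open>i + 0\<close> and \<open>i + 1\<close> are the two parities in some
      order.\<close>
    have "d ` V i \<subseteq> V (i + 0)" "d ` V i \<subseteq> V (i + 1)"
      using assms unfolding super_End_def by blast+
    then show ?thesis using that by (cases i) auto
  qed
  obtain x0 x1 where x: "x0 \<in> V 0" "x1 \<in> V 1" "x = x0 + x1"
    using components_span by blast
  have "d x = d x0 + d x1"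
    using assms x unfolding super_End_def Vector_Spaces.linear_iff by simp
  then show "d x = 0 x"
    using *[OF x(1)] *[OF x(2)] components_disjoint by auto
qed

text \<open>The difference \<open>d0 - e0 = e1 - d1\<close> is both even and odd, hence
  zero.\<close>

lemma super_End_sum_unique:
  assumes "d0 \<in> super_End scale V 0" "e0 \<in> super_End scale V 0"
    and "d1 \<in> super_End scale V 1" "e1 \<in> super_End scale V 1"
    and eq: "d0 + d1 = e0 + e1"
  shows "d0 = e0" "d1 = e1"
proof -
  interpret fn: vector_space "\<lambda>c d x. scale c (d x)"
    by (rule vector_space_fun) unfold_locales
  have "d0 - e0 = e1 - d1"
    using eq by (simp add: algebra_simps)
  then have "d0 - e0 = 0"
    using assms fn.subspace_diff[OF subspace_super_End] by (metis super_End_disjoint)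
  then show "d0 = e0" by simp
  then show "d1 = e1" using eq by simp
qed

end

section \<open>The superspace U and the extension of maps from V\<close>

locale super_form = superspace scale V
  for scale :: "'f::field_char_0 \<Rightarrow> 'v::ab_group_add \<Rightarrow> 'v" and V +
  fixes f :: "'v \<Rightarrow> 'v \<Rightarrow> 'f"
    and star :: "'v \<Rightarrow> 'v \<Rightarrow> 'v" (infixl "\<star>" 70)
  assumes form: "bilinear_form scale f"
    and susy: "supersymmetric V f"
    and nondeg: "nondegenerate f"
    and bilin: "bilinear_map scale scale (\<star>)"
    and anti: "superanticommutative scale V (\<star>)"
begin

lemmas form_0 [simp] = bilinear_map_0[OF form]
lemmas star_0 [simp] = bilinear_map_0[OF bilin]

lemma zero_component [simp]: "0 \<in> V i"
  using subspace_component by (rule subspace_0)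

lemma form_add: "f (x + y) z = f x z + f y z" "f x (y + z) = f x y + f x z"
  and form_scale: "f (scale c x) y = c * f x y" "f x (scale c y) = c * f x y"
  using form unfolding bilinear_map_iff by auto

lemma star_add: "(x + y) \<star> z = x \<star> z + y \<star> z" "x \<star> (y + z) = x \<star> y + x \<star> z"
  and star_scale: "scale c x \<star> y = scale c (x \<star> y)" "x \<star> scale c y = scale c (x \<star> y)"
  using bilin unfolding bilinear_map_iff by auto

text \<open>Makes the facts on superspaces, in particular \<open>Der_eq_sum\<close>, available for
  U.\<close>

lemma superspace_U: "superspace (U_scale scale) (U_component V :: bit \<Rightarrow> ('f \<times> 'v) set)"
proof -
  interpret U: vector_space "U_scale scale"
    by unfold_locales (auto simp: U_scale_def algebra_simps)
  show ?thesis
  proof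
    show "U.subspace (U_component V i)" for i
      using subspace_component[of i]
      by (cases i) (auto simp: U.subspace_def U_component_def U_scale_def subspace_def zero_prod_def)
    show "U_component V 0 \<inter> U_component V 1 = {0 :: 'f \<times> 'v}"
      using components_disjoint by (auto simp: U_component_def zero_prod_def)
    show "\<exists>x0\<in>U_component V 0. \<exists>x1\<in>U_component V 1. x = x0 + x1" for x :: "'f \<times> 'v"
    proof -
      obtain x0 x1 where "x0 \<in> V 0" "x1 \<in> V 1" "snd x = x0 + x1"
        using components_span by blast
      then have "(fst x, x0) \<in> U_component V 0" "(0, x1) \<in> U_component V 1"
          "x = (fst x, x0) + (0, x1)"
        by (auto simp: U_component_def prod_eq_iff)
      then show ?thesis by blast
    qed
  qed
qed

lemma bilinear_U_mult: "bilinear_map (U_scale scale) (U_scale scale) (U_mult scale f (\<star>))"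
proof -
  interpret U: superspace "U_scale scale" "U_component V :: bit \<Rightarrow> ('f \<times> 'v) set"
    by (rule superspace_U)
  have "vector_space (U_scale scale)" by unfold_locales
  then show ?thesis
    unfolding bilinear_map_iff
    by (auto simp: U_mult_def U_scale_def form_add form_scale star_add star_scale algebra_simps)
qed

lemma linear_U_extend:
  assumes "Vector_Spaces.linear scale scale d"
  shows "Vector_Spaces.linear (U_scale scale) (U_scale scale) (U_extend d)"
  using assms bilinear_U_mult
  by (auto simp: Vector_Spaces.linear_iff bilinear_map_iff U_extend_def U_scale_def)

lemma U_component_iff: "(a, x) \<in> U_component V i \<longleftrightarrow> x \<in> V i \<and> (i = 0 \<or> a = 0)"
  by (cases i) (auto simp: U_component_def)

text \<open>The scalar component of the derivation rule in U is the \<open>Lieosp\<close> condition;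
  the V component is the rule for \<open>\<star>\<close> plus terms from scalar parts.\<close>

lemma U_extend_derivation:
  assumes L: "d \<in> Lieosp_component scale V f s"
    and H: "d \<in> homogeneous_derivations scale V (\<star>) s"
  shows "U_extend d \<in> homogeneous_derivations (U_scale scale) (U_component V) (U_mult scale f (\<star>)) s"
proof -
  have d: "Vector_Spaces.linear scale scale d" and dV: "\<And>i. d ` V i \<subseteq> V (i + s)"
    using H by (auto simp: homogeneous_derivations_def super_End_def)
  have "U_extend d ` U_component V i \<subseteq> U_component V (i + s)" for i
    using dV[of i] by (cases i; cases s) (auto simp: U_extend_def U_component_iff image_subset_iff)
  moreover have "U_extend d (U_mult scale f (\<star>) x y) =
      U_scale scale (parity_sign s j) (U_mult scale f (\<star>) (U_extend d x) y)
        + U_mult scale f (\<star>) x (U_extend d y)"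
    if "x \<in> U_component V i" "y \<in> U_component V j" for i j x y
  proof (cases x; cases y)
    fix a u b v assume xy: "x = (a, u)" "y = (b, v)"
    have uv: "u \<in> V i" "v \<in> V j" and b: "j = 0 \<or> b = 0"
      using that xy by (auto simp: U_component_iff)
    have 1: "parity_sign s j * f (d u) v + f u (d v) = 0"
      using L uv by (auto simp: Lieosp_component_def)
    have 2: "d (u \<star> v) = scale (parity_sign s j) (d u \<star> v) + u \<star> d v"
      using H uv by (auto simp: homogeneous_derivations_def)
    \<comment> \<open>A sign can only appear for \<open>j = 1\<close>, and odd elements of U have
      scalar part \<open>b = 0\<close>.\<close>
    have 3: "scale (parity_sign s j) (scale b (d u)) = scale b (d u)"
      using b by auto
    show ?thesis
      using d 1 2 3 unfolding Vector_Spaces.linear_iff xy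
      by (simp add: U_mult_def U_extend_def U_scale_def scale_right_distrib algebra_simps)
  qed
  ultimately show ?thesis
    using linear_U_extend[OF d] unfolding homogeneous_derivations_def super_End_def by blast
qed

section \<open>Homogeneous derivations of U\<close>

lemma U_derivation_unit:
  assumes "D \<in> homogeneous_derivations (U_scale scale) (U_component V) (U_mult scale f (\<star>)) s"
  shows "D (1, 0) = 0"
proof -
  have "(1, 0) \<in> U_component V 0"
    by (simp add: U_component_iff)
  then have "D (U_mult scale f (\<star>) (1, 0) (1, 0)) =
      U_scale scale (parity_sign s 0) (U_mult scale f (\<star>) (D (1, 0)) (1, 0))
        + U_mult scale f (\<star>) (1, 0) (D (1, 0))"
    using assms unfolding homogeneous_derivations_def by blast
  then have "D (1, 0) = D (1, 0) + D (1, 0)"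
    by (cases "D (1, 0)") (simp add: U_mult_def U_scale_def)
  then show ?thesis by simp
qed

lemma U_derivation_mult:
  fixes D s
  defines "\<phi> \<equiv> \<lambda>x. fst (D (0, x))" and "d \<equiv> \<lambda>x. snd (D (0, x))"
  assumes D: "D \<in> homogeneous_derivations (U_scale scale) (U_component V) (U_mult scale f (\<star>)) s"
    and xy: "x \<in> V i" "y \<in> V j"
  shows "\<phi> (x \<star> y) = parity_sign s j * f (d x) y + f x (d y)"
    and "d (x \<star> y) = scale (parity_sign s j) (scale (\<phi> x) y + d x \<star> y) + (scale (\<phi> y) x + x \<star> d y)"
proof -
  have lin: "Vector_Spaces.linear (U_scale scale) (U_scale scale) D"
    using D by (auto simp: homogeneous_derivations_def super_End_def)
  \<comment> \<open>The scalar part of the product is a multiple of the unit, so \<open>D\<close>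
    does not see it.\<close>
  have "D (f x y, x \<star> y) = D (U_scale scale (f x y) (1, 0) + (0, x \<star> y))"
    by (simp add: U_scale_def)
  also have "\<dots> = D (0, x \<star> y)"
  proof -
    have "D (u + v) = D u + D v" "D (U_scale scale c u) = U_scale scale c (D u)" for u v c
      using lin unfolding Vector_Spaces.linear_iff by blast+
    moreover have "U_scale scale (f x y) 0 = 0"
      by (simp add: U_scale_def zero_prod_def)
    ultimately show ?thesis
      using U_derivation_unit[OF D] by simp
  qed
  finally have 1: "D (f x y, x \<star> y) = D (0, x \<star> y)" .
  have "(0, x) \<in> U_component V i" "(0, y) \<in> U_component V j"
    using xy by (simp_all add: U_component_iff)
  then have "D (U_mult scale f (\<star>) (0, x) (0, y)) =
      U_scale scale (parity_sign s j) (U_mult scale f (\<star>) (D (0, x)) (0, y))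
        + U_mult scale f (\<star>) (0, x) (D (0, y))"
    using D unfolding homogeneous_derivations_def by blast
  then have "D (0, x \<star> y) = (parity_sign s j * f (d x) y + f x (d y),
      scale (parity_sign s j) (scale (\<phi> x) y + d x \<star> y) + (scale (\<phi> y) x + x \<star> d y))"
    using 1 unfolding \<phi>_def d_def
    by (cases "D (0, x)"; cases "D (0, y)") (simp add: U_mult_def U_scale_def)
  then show "\<phi> (x \<star> y) = parity_sign s j * f (d x) y + f x (d y)"
    and "d (x \<star> y) = scale (parity_sign s j) (scale (\<phi> x) y + d x \<star> y) + (scale (\<phi> y) x + x \<star> d y)"
    by (simp_all add: \<phi>_def d_def)
qed

lemma U_derivation_fst_homogeneous:
  assumes D: "D \<in> homogeneous_derivations (U_scale scale) (U_component V) (U_mult scale f (\<star>)) s"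
    and x: "x \<in> V i"
  shows "fst (D (0, x)) = 0"
proof -
  define \<phi> where "\<phi> = (\<lambda>x. fst (D (0, x)))"
  define d where "d = (\<lambda>x. snd (D (0, x)))"
  have "Vector_Spaces.linear (U_scale scale) (U_scale scale) D"
    using D by (simp add: homogeneous_derivations_def super_End_def)
  then have D0: "D 0 = 0"
    unfolding Vector_Spaces.linear_iff by (metis add_cancel_left_left)
  have "D (0, y) \<in> U_component V (k + s)" if "y \<in> V k" for k y
  proof -
    have "(0, y) \<in> U_component V k" using that by (simp add: U_component_iff)
    then show ?thesis
      using D unfolding homogeneous_derivations_def super_End_def by blast
  qed
  then have Dc: "d y \<in> V (k + s) \<and> (k + s = 0 \<or> \<phi> y = 0)" if "y \<in> V k" for k y
    using that unfolding d_def \<phi>_def by (metis U_component_iff prod.collapse)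
  have der: "d (u \<star> v) =
      scale (parity_sign s l) (scale (\<phi> u) v + d u \<star> v) + (scale (\<phi> v) u + u \<star> d v)"
    if "u \<in> V k" "v \<in> V l" for u v k l
    unfolding d_def \<phi>_def using D that by (rule U_derivation_mult(2))
  have comm: "u \<star> v = - scale (parity_sign k l) (v \<star> u)" if "u \<in> V k" "v \<in> V l" for u v k l
    using anti that unfolding superanticommutative_def by blast
  have sym: "f u v = parity_sign k l * f v u" if "u \<in> V k" "v \<in> V l" for u v k l
    using susy that unfolding supersymmetric_def by blast
  \<comment> \<open>\<open>1 + 1\<close> is a nonzero scalar in characteristic zero.\<close>
  have double: "a = 0" if "a + a = 0" for a :: 'v
  proof -
    have "scale (1 + 1) a = 0" using that by (simp only: scale_left_distrib scale_one)
    then show ?thesis by simp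
  qed
  have "\<phi> x = 0"
  proof (rule ccontr)
    assume nz: "\<phi> x \<noteq> 0"
    \<comment> \<open>Scalars are even, so a nonzero \<open>\<phi> x\<close> forces
      \<open>i + s = 0\<close>, which in \<open>bit\<close> means \<open>i = s\<close>.\<close>
    then have i: "i = s" using Dc[OF x] by (cases i; cases s) auto
    have x0: "x \<noteq> 0" using nz D0 by (auto simp: \<phi>_def zero_prod_def)
    show False
    proof (cases s)
      case zero
      have "x \<star> x = 0" using comm[of x 0 x 0] x i zero double[of "x \<star> x"]
        by (simp add: eq_neg_iff_add_eq_0)
      moreover have "d 0 = 0" using D0 by (simp add: d_def zero_prod_def)
      moreover have "d x \<star> x = - (x \<star> d x)"
        using comm[of "d x" 0 x 0] Dc[OF x] x i zero by simp
      \<comment> \<open>The rule for \<open>x \<star> x = 0\<close>: the two \<open>\<star>\<close>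
        terms cancel and only the scalar contributions remain.\<close>
      ultimately have "scale (\<phi> x) x + scale (\<phi> x) x = 0"
        using der[OF x x] zero by simp
      then have "scale (\<phi> x) x = 0" by (rule double)
      then show False using nz x0 by simp
    next
      case one
      have x1: "x \<in> V 1" and dx: "d x \<in> V 0" using x Dc[OF x] i one by auto
      \<comment> \<open>For odd elements \<open>x \<star> y = y \<star> x\<close>. Both expansions
        of its image under \<open>d\<close> contain the same \<open>\<star>\<close> terms, so their
        difference is twice the claimed relation.\<close>
      have collinear: "scale (\<phi> x) y = scale (\<phi> y) x" if y: "y \<in> V 1" for y
      proof -
        have "d y \<in> V 0" using Dc[OF y] one by simp
        then have "d y \<star> x = - (x \<star> d y)" "d x \<star> y = - (y \<star> d x)" "x \<star> y = y \<star> x"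
          using comm[of "d y" 0 x 1] comm[of "d x" 0 y 1] comm[of x 1 y 1] x1 dx y by simp_all
        then have "(scale (\<phi> x) y - scale (\<phi> y) x) + (scale (\<phi> x) y - scale (\<phi> y) x) = 0"
          using der[OF x1 y] der[OF y x1] one by (simp add: algebra_simps)
        then have "scale (\<phi> x) y - scale (\<phi> y) x = 0" by (rule double)
        then show ?thesis by simp
      qed
      have xx: "f x x = 0" using sym[OF x1 x1] by simp
      have "f x y = 0" for y
      proof -
        obtain y0 y1 where y: "y0 \<in> V 0" "y1 \<in> V 1" "y = y0 + y1"
          using components_span by blast
        \<comment> \<open>This is \<open>f x\<close> applied to the relation
          \<open>collinear\<close>.\<close>
        have "\<phi> x * f x y1 = \<phi> y1 * f x x"
          using collinear[OF y(2)] form_scale(2) by metis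
        then have "f x y1 = 0" using xx nz by simp
        moreover have "f x y0 = 0"
          using sym[OF x1 y(1)] susy x1 y(1) by (simp add: supersymmetric_def)
        ultimately show ?thesis using y(3) by (simp add: form_add)
      qed
      then show False using nondeg x0 unfolding nondegenerate_def by blast
    qed
  qed
  then show ?thesis by (simp add: \<phi>_def)
qed

text \<open>Converse of \<open>U_extend_derivation\<close>: the scalar part of \<open>D\<close>
  vanishes on homogeneous vectors, hence on V, and \<open>D\<close> kills the unit, so
  \<open>D\<close> is determined by its V component there.\<close>

lemma U_derivation_restrict:
  assumes D: "D \<in> homogeneous_derivations (U_scale scale) (U_component V) (U_mult scale f (\<star>)) s"
  obtains d where "D = U_extend d" "d \<in> Lieosp_component scale V f s"
    "d \<in> homogeneous_derivations scale V (\<star>) s"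
proof -
  define d where "d = (\<lambda>x. snd (D (0, x)))"
  have "Vector_Spaces.linear (U_scale scale) (U_scale scale) D"
    using D by (simp add: homogeneous_derivations_def super_End_def)
  then have lin: "D (u + v) = D u + D v" "D (U_scale scale c u) = U_scale scale c (D u)" for u v c
    unfolding Vector_Spaces.linear_iff by blast+
  have D_V: "D (0, x) = (0, d x)" for x
  proof -
    obtain x0 x1 where x: "x0 \<in> V 0" "x1 \<in> V 1" "x = x0 + x1"
      using components_span by blast
    have "D (0, x) = D (0, x0) + D (0, x1)"
      using lin(1)[of "(0, x0)" "(0, x1)"] x(3) by simp
    then show ?thesis
      using x U_derivation_fst_homogeneous[OF D] by (simp add: d_def prod_eq_iff)
  qed
  have "D (a, x) = U_scale scale a (D (1, 0)) + D (0, x)" for a x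
    using lin(1)[of "U_scale scale a (1, 0)" "(0, x)"] lin(2)[of a "(1, 0)"]
    by (simp add: U_scale_def)
  then have ext: "D = U_extend d"
    using D_V U_derivation_unit[OF D] by (auto simp: U_extend_def U_scale_def zero_prod_def)
  have "d (x + y) = d x + d y" "d (scale c x) = scale c (d x)" for x y c
    using lin(1)[of "(0, x)" "(0, y)"] lin(2)[of c "(0, x)"] by (simp_all add: D_V U_scale_def)
  then have "Vector_Spaces.linear scale scale d"
    using vector_space_axioms by (simp add: Vector_Spaces.linear_iff)
  moreover have "d ` V i \<subseteq> V (i + s)" for i
  proof
    fix z assume "z \<in> d ` V i"
    then obtain x where x: "x \<in> V i" "z = d x" by blast
    then have "(0, x) \<in> U_component V i" by (simp add: U_component_iff)
    then have "D (0, x) \<in> U_component V (i + s)"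
      using D unfolding homogeneous_derivations_def super_End_def by blast
    then show "z \<in> V (i + s)"
      unfolding D_V U_component_iff using x(2) by blast
  qed
  ultimately have "d \<in> super_End scale V s"
    by (simp add: super_End_def)
  \<comment> \<open>With \<open>D (0, x) = (0, d x)\<close> all terms in \<open>\<phi>\<close>
    vanish from \<open>U_derivation_mult\<close>, leaving the two required conditions.\<close>
  then show thesis
    using that[OF ext] U_derivation_mult[OF D]
    by (simp add: Lieosp_component_def homogeneous_derivations_def D_V)
qed

section \<open>Combining the two parities\<close>

lemma Lieosp_Int_Der:
  "Lieosp scale V f \<inter> Der scale V (\<star>) = {d0 + d1 | d0 d1.
     d0 \<in> Lieosp_component scale V f 0 \<inter> homogeneous_derivations scale V (\<star>) 0 \<and>
     d1 \<in> Lieosp_component scale V f 1 \<inter> homogeneous_derivations scale V (\<star>) 1}"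
    (is "?A = ?B")
proof
  show "?A \<subseteq> ?B"
  proof
    fix d assume "d \<in> ?A"
    then obtain d0 d1 e0 e1 where d: "d = d0 + d1" "d0 \<in> Lieosp_component scale V f 0"
        "d1 \<in> Lieosp_component scale V f 1"
      and e: "d = e0 + e1" "e0 \<in> homogeneous_derivations scale V (\<star>) 0"
        "e1 \<in> homogeneous_derivations scale V (\<star>) 1"
      unfolding Lieosp_def Der_eq_sum[OF bilin] by blast
    \<comment> \<open>The \<open>Lieosp\<close> splitting and the derivation splitting of
      \<open>d\<close> are both splittings by parity, so they coincide.\<close>
    have "d0 = e0" "d1 = e1"
      using super_End_sum_unique[of d0 e0 d1 e1] d e
      by (auto simp: Lieosp_component_def homogeneous_derivations_def)
    then show "d \<in> ?B" using d e by blast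
  qed
  show "?B \<subseteq> ?A"
    unfolding Lieosp_def Der_eq_sum[OF bilin] by blast
qed

text \<open>\<open>U_extend\<close> maps onto the derivations of U in each parity separately; since
  it is additive, this passes to sums.\<close>

lemma Der_U:
  "Der (U_scale scale) (U_component V) (U_mult scale f (\<star>)) =
     U_extend ` (Lieosp scale V f \<inter> Der scale V (\<star>))"
proof -
  let ?H = "homogeneous_derivations (U_scale scale) (U_component V) (U_mult scale f (\<star>))"
  interpret U: superspace "U_scale scale" "U_component V :: bit \<Rightarrow> ('f \<times> 'v) set"
    by (rule superspace_U)
  let ?LH = "\<lambda>s. Lieosp_component scale V f s \<inter> homogeneous_derivations scale V (\<star>) s"
  have H: "?H s = U_extend ` ?LH s" for s
  proof
    show "?H s \<subseteq> U_extend ` ?LH s"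
    proof
      fix D assume "D \<in> ?H s"
      then show "D \<in> U_extend ` ?LH s"
        by (rule U_derivation_restrict) blast
    qed
    show "U_extend ` ?LH s \<subseteq> ?H s"
      using U_extend_derivation by blast
  qed
  have add: "U_extend (d0 + d1) = (U_extend d0 + U_extend d1 :: 'f \<times> 'v \<Rightarrow> _)"
    for d0 d1 :: "'v \<Rightarrow> 'v"
    by (auto simp: U_extend_def)
  have "U_extend ` (Lieosp scale V f \<inter> Der scale V (\<star>)) =
      {U_extend d0 + U_extend d1 :: 'f \<times> 'v \<Rightarrow> _ | d0 d1. d0 \<in> ?LH 0 \<and> d1 \<in> ?LH 1}"
    unfolding Lieosp_Int_Der add[symmetric] by blast
  also have "\<dots> = {D0 + D1 | D0 D1. D0 \<in> ?H 0 \<and> D1 \<in> ?H 1}"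
    unfolding H by blast
  finally show ?thesis
    unfolding U.Der_eq_sum[OF bilinear_U_mult] by (rule sym)
qed

end

theorem lemma11:
  fixes scale :: "'f::field_char_0 \<Rightarrow> 'v::ab_group_add \<Rightarrow> 'v"
    and V :: "bit \<Rightarrow> 'v set"
    and f :: "'v \<Rightarrow> 'v \<Rightarrow> 'f"
    and star :: "'v \<Rightarrow> 'v \<Rightarrow> 'v" (infixl "\<star>" 70)
  assumes "superspace scale V"
    and "bilinear_form scale f"
    and "supersymmetric V f"
    and "nondegenerate f"
    and "bilinear_map scale scale (\<star>)"
    and "superanticommutative scale V (\<star>)"
    and "\<And>x y z. f (x \<star> y) z = f x (y \<star> z)"
  shows "Der (U_scale scale) (U_component V) (U_mult scale f (\<star>)) =
         U_extend ` (Lieosp scale V f \<inter> Der scale V (\<star>))"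
proof -
  interpret super_form scale V f star
    using assms by (simp add: super_form_def super_form_axioms_def)
  show ?thesis by (rule Der_U)
qed

end
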